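(* For every $n\geq 1$, the reduced Heisenberg group $\mathbb{H}_{r}^{n}$ is not wavelet complete.
   Context: The reduced Heisenberg group is $\mathbb{H}_{r}^{n}:=\mathbb{R}^n\times\mathbb{R}^n\times\mathbb{T}$ (with $\mathbb{T}=\{z\in\mathbb{C}:|z|=1\}$ and the product topology) with the product $$\big(x,\omega,e^{2\pi i\tau}\big)\cdot\big(x',\omega',e^{2\pi i\tau'}\big):=\big(x+x',\omega+\omega',e^{2\pi i(\tau+\tau')}e^{\pi i(x'\cdot\omega-x\cdot\omega')}\big).$$ It is unimodular, with Haar measure the usual product measure. For a locally compact (Hausdorff) group $G$, $L^2(G)$ is taken with respect to a fixed left Haar measure, and inner products are linear in the first argument. A unitary representation $\pi:G\to\mathcal{U}(\mathcal{H}_{\pi})$ is a group homomorphism into the unitary operators of a Hilbert space such that for all $f,g\in\mathcal{H}_\pi$ the function (wavelet transform) $\mathcal{W}_{g}f(x):=\langle f,\pi(x)g\rangle_{\mathcal{H}_\pi}$ is continuous on $G$. It is irreducible if its only closed invariant subspaces are $\{0\}$ and $\mathcal{H}_\pi$. A square integrable representation is an irreducible unitary representation $\pi$ for which there is a non-zero $g\in\mathcal{H}_\pi$ with $\mathcal{W}_g g\in L^2(G)$; such a $g$ is called a square integrable vector. By the Duflo-Moore theorem there is a unique positive, densely defined, injective operator $C_\pi$ on $\mathcal{H}_\pi$, whose domain consists of $0$ and the square integrable vectors, with $\langle\mathcal{W}_{g_1}f_1,\mathcal{W}_{g_2}f_2\rangle_{L^2(G)}=\langle f_1,f_2\rangle\,\overline{\langle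 C_\pi g_1,C_\pi g_2\rangle}$ for all $f_1,f_2\in\mathcal{H}_\pi$ and $g_1,g_2\in\mathrm{dom}(C_\pi)$. A square integrable vector $g$ is admissible if $\|C_\pi g\|=1$; equivalently, $\mathcal{W}_g:\mathcal{H}_\pi\to L^2(G)$ is an isometry. Let $\mathcal{A}_\pi$ denote the set of equivalence classes of admissible vectors in $\mathcal{H}_\pi$ modulo multiplication by elements of $\mathbb{T}$, and $\widehat{G}_s$ the set of (unitary) equivalence classes of square integrable representations of $G$. The group $G$ is called wavelet complete if $$\overline{\bigoplus_{\pi\in\widehat{G}_s}\underset{g\in\mathcal{A}_\pi}{\mathrm{span}}\big\{\mathcal{W}_gf:f\in\mathcal{H}_\pi\big\}}=L^2(G),$$ i.e. if the linear span of all functions $\mathcal{W}_gf$, with $\pi$ ranging over the square integrable representations of $G$, $g$ over the admissible vectors of $\pi$, and $f$ over $\mathcal{H}_\pi$, is dense in $L^2(G)$. *)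

theory Defs
  imports "HOL-Analysis.Analysis" "HOL-Algebra.Module" "HOL-Algebra.Bij"
    "HOL-Algebra.Algebraic_Closure_Type"
begin

section \<open>Complex Hilbert spaces\<close>

text \<open>
  The representation spaces vary, so they are carrier-based: a \<^emph>\<open>module\<close> record over the
  field of complex numbers together with an inner product that is linear in the first argument.
  The fields \<^emph>\<open>mult\<close> and \<^emph>\<open>one\<close> that the record inherits play no role.
\<close>

abbreviation complex_field :: "complex ring" where
  "complex_field \<equiv> ring_of_type_algebra"

record 'h hilbert = "(complex, 'h) module" +
  cinner :: "'h \<Rightarrow> 'h \<Rightarrow> complex"

definition hnorm :: "('h, 'm) hilbert_scheme \<Rightarrow> 'h \<Rightarrow> real" where
  "hnorm H v = sqrt (Re (cinner H v v))"

text \<open>The value \<^emph>\<open>0\<close> off the carrier makes the distance function symmetric everywhere, as the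
  locale \<^locale>\<open>Metric_space\<close> demands.\<close>

definition hdist :: "('h, 'm) hilbert_scheme \<Rightarrow> 'h \<Rightarrow> 'h \<Rightarrow> real" where
  "hdist H v w =
     (if v \<in> carrier H \<and> w \<in> carrier H then hnorm H (v \<ominus>\<^bsub>H\<^esub> w) else 0)"

abbreviation htopology :: "('h, 'm) hilbert_scheme \<Rightarrow> 'h topology" where
  "htopology H \<equiv> Metric_space.mtopology (carrier H) (hdist H)"

locale complex_inner_product_space = module complex_field H
  for H :: "('h, 'm) hilbert_scheme" (structure) +
  assumes cinner_add_left:
      "\<lbrakk>u \<in> carrier H; v \<in> carrier H; w \<in> carrier H\<rbrakk>
        \<Longrightarrow> cinner H (u \<oplus> v) w = cinner H u w + cinner H v w"
    and cinner_smult_left: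
      "\<lbrakk>v \<in> carrier H; w \<in> carrier H\<rbrakk>
        \<Longrightarrow> cinner H (c \<odot>\<^bsub>H\<^esub> v) w = c * cinner H v w"
    and cinner_commute:
      "\<lbrakk>v \<in> carrier H; w \<in> carrier H\<rbrakk> \<Longrightarrow> cinner H v w = cnj (cinner H w v)"
    and cinner_ge_zero: "v \<in> carrier H \<Longrightarrow> 0 \<le> Re (cinner H v v)"
    and cinner_eq_zero: "\<lbrakk>v \<in> carrier H; cinner H v v = 0\<rbrakk> \<Longrightarrow> v = \<zero>"

context complex_inner_product_space
begin

lemma complex_field_carrier [simp]: "c \<in> carrier complex_field"
  by (simp add: ring_of_type_algebra_def)

lemma cinner_add_right:
  "\<lbrakk>u \<in> carrier H; v \<in> carrier H; w \<in> carrier H\<rbrakk>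
    \<Longrightarrow> cinner H w (u \<oplus> v) = cinner H w u + cinner H w v"
  by (metis a_closed cinner_add_left cinner_commute complex_cnj_add)

lemma cinner_smult_right:
  "\<lbrakk>v \<in> carrier H; w \<in> carrier H\<rbrakk> \<Longrightarrow> cinner H w (c \<odot>\<^bsub>H\<^esub> v) = cnj c * cinner H w v"
  by (metis cinner_commute cinner_smult_left complex_cnj_mult complex_field_carrier smult_closed)

lemma cinner_self: "v \<in> carrier H \<Longrightarrow> cinner H v v = of_real ((hnorm H v)\<^sup>2)"
  using cinner_ge_zero[of v] cinner_commute[of v v]
  by (simp add: hnorm_def complex_eq_iff)

lemma hnorm_ge_zero: "v \<in> carrier H \<Longrightarrow> 0 \<le> hnorm H v"
  by (simp add: hnorm_def cinner_ge_zero)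

lemma hnorm_eq_zero: "v \<in> carrier H \<Longrightarrow> hnorm H v = 0 \<longleftrightarrow> v = \<zero>"
proof -
  assume v: "v \<in> carrier H"
  have "cinner H \<zero> \<zero> = 0"
    using cinner_add_left[of \<zero> \<zero> \<zero>] by simp
  moreover have "hnorm H v = 0 \<Longrightarrow> cinner H v v = 0"
    by (simp add: cinner_self[OF v])
  ultimately show ?thesis
    using cinner_eq_zero[OF v] by (auto simp: hnorm_def)
qed

lemma hnorm_minus_one: "v \<in> carrier H \<Longrightarrow> hnorm H ((-1) \<odot>\<^bsub>H\<^esub> v) = hnorm H v"
  by (simp add: hnorm_def cinner_smult_left cinner_smult_right)

lemma uminus_eq_smult: "v \<in> carrier H \<Longrightarrow> \<ominus> v = (-1) \<odot>\<^bsub>H\<^esub> v"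
proof -
  assume v: "v \<in> carrier H"
  have "v \<oplus> (-1) \<odot>\<^bsub>H\<^esub> v = (1 + (-1)) \<odot>\<^bsub>H\<^esub> v"
    using v smult_l_distr[of 1 "-1" v] smult_one[of v] by (simp add: ring_of_type_algebra_def)
  also have "\<dots> = \<zero>"
    using v smult_l_null[of v] by (simp add: ring_of_type_algebra_def)
  finally show ?thesis
    using v by (metis complex_field_carrier minus_equality smult_closed a_comm)
qed

lemma Re_cinner_le:
  assumes v: "v \<in> carrier H" and w: "w \<in> carrier H"
  shows "Re (cinner H v w) \<le> hnorm H v * hnorm H w"
proof (cases "v = \<zero> \<or> w = \<zero>")
  case True
  have "cinner H \<zero> w = 0" "cinner H v \<zero> = 0"
    using cinner_add_left[of \<zero> \<zero> w] cinner_add_right[of \<zero> \<zero> v] v w by simp_all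
  with True show ?thesis
    using v w by (auto simp: hnorm_ge_zero)
next
  case False
  define a b where "a = hnorm H v" and "b = hnorm H w"
  have pos: "a * b > 0"
    using False v w hnorm_ge_zero hnorm_eq_zero by (auto simp: a_def b_def less_le)
  let ?u = "of_real b \<odot>\<^bsub>H\<^esub> v \<oplus> of_real (- a) \<odot>\<^bsub>H\<^esub> w"
  have "cinner H w v = cnj (cinner H v w)"
    using v w by (rule cinner_commute[rotated])
  then have "cinner H ?u ?u
      = of_real b * (of_real b * of_real (a\<^sup>2)) + of_real b * (of_real (- a) * cnj (cinner H v w))
      + (of_real (- a) * (of_real b * cinner H v w) + of_real (- a) * (of_real (- a) * of_real (b\<^sup>2)))"
    using v w unfolding a_def b_def
    by (simp only: cinner_add_left cinner_add_right cinner_smult_left cinner_smult_right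
        cinner_self[OF v] cinner_self[OF w] smult_closed M.a_closed complex_field_carrier
        complex_cnj_complex_of_real distrib_left)
  moreover have "Re \<dots> = 2 * (a * b) * (a * b - Re (cinner H v w))"
    by (simp add: power2_eq_square right_diff_distrib)
  ultimately have "Re (cinner H ?u ?u) = 2 * (a * b) * (a * b - Re (cinner H v w))"
    by (rule ssubst)
  moreover have "0 \<le> Re (cinner H ?u ?u)"
    using v w by (intro cinner_ge_zero) simp
  ultimately have "0 \<le> a * b - Re (cinner H v w)"
    using pos by (simp add: zero_le_mult_iff)
  then show ?thesis
    by (simp add: a_def b_def)
qed

lemma hnorm_triangle:
  assumes v: "v \<in> carrier H" and w: "w \<in> carrier H"
  shows "hnorm H (v \<oplus> w) \<le> hnorm H v + hnorm H w"
proof -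
  have "cinner H w v = cnj (cinner H v w)"
    using v w by (rule cinner_commute[rotated])
  then have "cinner H (v \<oplus> w) (v \<oplus> w)
      = of_real ((hnorm H v)\<^sup>2) + of_real ((hnorm H w)\<^sup>2) + (cinner H v w + cnj (cinner H v w))"
    using v w
    by (simp add: cinner_add_left cinner_add_right cinner_self[OF v] cinner_self[OF w])
  also have "\<dots> = of_real ((hnorm H v)\<^sup>2 + (hnorm H w)\<^sup>2 + 2 * Re (cinner H v w))"
    by (simp only: complex_add_cnj of_real_add)
  finally have "Re (cinner H (v \<oplus> w) (v \<oplus> w))
      = (hnorm H v)\<^sup>2 + (hnorm H w)\<^sup>2 + 2 * Re (cinner H v w)"
    by (simp only: Re_complex_of_real)
  moreover have "(hnorm H (v \<oplus> w))\<^sup>2 = Re (cinner H (v \<oplus> w) (v \<oplus> w))"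
    unfolding hnorm_def by (intro real_sqrt_pow2 cinner_ge_zero M.a_closed v w)
  ultimately have "(hnorm H (v \<oplus> w))\<^sup>2 \<le> (hnorm H v + hnorm H w)\<^sup>2"
    using Re_cinner_le[OF v w] unfolding power2_sum by linarith
  moreover have "0 \<le> hnorm H v + hnorm H w"
    using v w by (intro add_nonneg_nonneg hnorm_ge_zero)
  ultimately show ?thesis
    by (rule power2_le_imp_le)
qed

lemma Metric_space_hilbert: "Metric_space (carrier H) (hdist H)"
proof
  fix x y z
  show "0 \<le> hdist H x y"
    by (simp add: hdist_def hnorm_ge_zero)
  show "hdist H x y = hdist H y x"
  proof (cases "x \<in> carrier H \<and> y \<in> carrier H")
    case True
    then have "y \<ominus> x = (-1) \<odot>\<^bsub>H\<^esub> (x \<ominus> y)"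
      by (simp add: minus_add a_minus_def a_comm flip: uminus_eq_smult)
    with True show ?thesis
      by (simp add: hdist_def hnorm_minus_one)
  qed (auto simp: hdist_def)
  assume x: "x \<in> carrier H" and y: "y \<in> carrier H"
  have "x \<ominus> y = \<zero> \<Longrightarrow> x = y"
    using x y by (metis M.add.inv_closed M.minus_equality M.minus_minus a_minus_def)
  then show "hdist H x y = 0 \<longleftrightarrow> x = y"
    using x y by (auto simp: hdist_def hnorm_eq_zero a_minus_def M.r_neg)
  assume z: "z \<in> carrier H"
  have "x \<ominus> z = (x \<ominus> y) \<oplus> (y \<ominus> z)"
    using x y z by (simp add: a_minus_def a_assoc M.r_neg1 M.r_neg2)
  then show "hdist H x z \<le> hdist H x y + hdist H y z"
    using x y z hnorm_triangle[of "x \<ominus> y" "y \<ominus> z"] by (simp add: hdist_def)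
qed

end

locale complex_hilbert_space = complex_inner_product_space +
  assumes complete: "Metric_space.mcomplete (carrier H) (hdist H)"

definition linear_map_on ::
    "('h, 'm) hilbert_scheme \<Rightarrow> 'h set \<Rightarrow> ('h \<Rightarrow> 'h) \<Rightarrow> bool" where
  "linear_map_on H D A \<longleftrightarrow>
     A \<in> D \<rightarrow> carrier H \<and>
     (\<forall>v\<in>D. \<forall>w\<in>D. A (v \<oplus>\<^bsub>H\<^esub> w) = A v \<oplus>\<^bsub>H\<^esub> A w) \<and>
     (\<forall>c. \<forall>v\<in>D. A (c \<odot>\<^bsub>H\<^esub> v) = c \<odot>\<^bsub>H\<^esub> A v)"

definition unitary_operators :: "('h, 'm) hilbert_scheme \<Rightarrow> ('h \<Rightarrow> 'h) set" where
  "unitary_operators H =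
     {U \<in> Bij (carrier H). linear_map_on H (carrier H) U \<and>
        (\<forall>v\<in>carrier H. \<forall>w\<in>carrier H. cinner H (U v) (U w) = cinner H v w)}"

definition unitary_group :: "('h, 'm) hilbert_scheme \<Rightarrow> ('h \<Rightarrow> 'h) monoid" where
  "unitary_group H = (BijGroup (carrier H))\<lparr>carrier := unitary_operators H\<rparr>"


section \<open>Square integrable functions\<close>

definition L2 :: "'a measure \<Rightarrow> ('a \<Rightarrow> complex) set" where
  "L2 M = {F \<in> borel_measurable M. integrable M (\<lambda>x. (cmod (F x))\<^sup>2)}"

definition L2_inner :: "'a measure \<Rightarrow> ('a \<Rightarrow> complex) \<Rightarrow> ('a \<Rightarrow> complex) \<Rightarrow> complex" where
  "L2_inner M F K = (LINT x|M. F x * cnj (K x))"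

definition complex_span :: "('a \<Rightarrow> complex) set \<Rightarrow> ('a \<Rightarrow> complex) set" where
  "complex_span S = {(\<lambda>x. \<Sum>F\<in>A. c F * F x) | A c. finite A \<and> A \<subseteq> S}"

definition L2_dense :: "'a measure \<Rightarrow> ('a \<Rightarrow> complex) set \<Rightarrow> bool" where
  "L2_dense M S \<longleftrightarrow>
     (\<forall>K\<in>L2 M. \<forall>\<epsilon>>0. \<exists>F\<in>S. (\<integral>\<^sup>+x. ennreal ((cmod (K x - F x))\<^sup>2) \<partial>M) < ennreal (\<epsilon>\<^sup>2))"


section \<open>Square integrable representations\<close>

text \<open>
  Throughout, \<^emph>\<open>G\<close> is a group, \<^emph>\<open>T\<close> its locally compact Hausdorff topology and \<^emph>\<open>M\<close> a left Haar
  measure on it.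
\<close>

definition wavelet_transform ::
    "('h, 'm) hilbert_scheme \<Rightarrow> ('g \<Rightarrow> 'h \<Rightarrow> 'h) \<Rightarrow> 'h \<Rightarrow> 'h \<Rightarrow> 'g \<Rightarrow> complex" where
  "wavelet_transform H \<pi> g f x = cinner H f (\<pi> x g)"

definition unitary_representation ::
    "'g monoid \<Rightarrow> 'g topology \<Rightarrow> ('h, 'm) hilbert_scheme \<Rightarrow> ('g \<Rightarrow> 'h \<Rightarrow> 'h) \<Rightarrow> bool" where
  "unitary_representation G T H \<pi> \<longleftrightarrow>
     complex_hilbert_space H \<and> \<pi> \<in> hom G (unitary_group H) \<and>
     (\<forall>f\<in>carrier H. \<forall>g\<in>carrier H. continuous_map T euclidean (wavelet_transform H \<pi> g f))"

definition irreducible_representation ::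
    "'g monoid \<Rightarrow> ('h, 'm) hilbert_scheme \<Rightarrow> ('g \<Rightarrow> 'h \<Rightarrow> 'h) \<Rightarrow> bool" where
  "irreducible_representation G H \<pi> \<longleftrightarrow>
     (\<forall>S. submodule S complex_field H \<and> closedin (htopology H) S \<and>
          (\<forall>x\<in>carrier G. \<pi> x ` S \<subseteq> S) \<longrightarrow> S = {\<zero>\<^bsub>H\<^esub>} \<or> S = carrier H)"

definition square_integrable_vectors ::
    "'g measure \<Rightarrow> ('h, 'm) hilbert_scheme \<Rightarrow> ('g \<Rightarrow> 'h \<Rightarrow> 'h) \<Rightarrow> 'h set" where
  "square_integrable_vectors M H \<pi> =
     {g \<in> carrier H. g \<noteq> \<zero>\<^bsub>H\<^esub> \<and> wavelet_transform H \<pi> g g \<in> L2 M}"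

definition square_integrable_representation ::
    "'g monoid \<Rightarrow> 'g topology \<Rightarrow> 'g measure \<Rightarrow> ('h, 'm) hilbert_scheme
      \<Rightarrow> ('g \<Rightarrow> 'h \<Rightarrow> 'h) \<Rightarrow> bool" where
  "square_integrable_representation G T M H \<pi> \<longleftrightarrow>
     unitary_representation G T H \<pi> \<and> irreducible_representation G H \<pi> \<and>
     square_integrable_vectors M H \<pi> \<noteq> {}"

definition duflo_moore_domain ::
    "'g measure \<Rightarrow> ('h, 'm) hilbert_scheme \<Rightarrow> ('g \<Rightarrow> 'h \<Rightarrow> 'h) \<Rightarrow> 'h set" where
  "duflo_moore_domain M H \<pi> = insert \<zero>\<^bsub>H\<^esub> (square_integrable_vectors M H \<pi>)"

definition duflo_moore_operator ::
    "'g measure \<Rightarrow> ('h, 'm) hilbert_scheme \<Rightarrow> ('g \<Rightarrow> 'h \<Rightarrow> 'h) \<Rightarrow> ('h \<Rightarrow> 'h) \<Rightarrow> bool" where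
  "duflo_moore_operator M H \<pi> C \<longleftrightarrow>
     (let D = duflo_moore_domain M H \<pi> in
       submodule D complex_field H \<and> htopology H closure_of D = carrier H \<and>
       linear_map_on H D C \<and> inj_on C D \<and>
       (\<forall>g\<in>D. cinner H (C g) g \<in> \<real>\<^sub>\<ge>\<^sub>0) \<and>
       (\<forall>f\<in>carrier H. \<forall>g\<in>D. wavelet_transform H \<pi> g f \<in> L2 M) \<and>
       (\<forall>f\<^sub>1\<in>carrier H. \<forall>f\<^sub>2\<in>carrier H. \<forall>g\<^sub>1\<in>D. \<forall>g\<^sub>2\<in>D.
          L2_inner M (wavelet_transform H \<pi> g\<^sub>1 f\<^sub>1) (wavelet_transform H \<pi> g\<^sub>2 f\<^sub>2)
            = cinner H f\<^sub>1 f\<^sub>2 * cnj (cinner H (C g\<^sub>1) (C g\<^sub>2))))"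

text \<open>
  The orthogonality relations determine the norm of \<^emph>\<open>C g\<close>, see \<^emph>\<open>hnorm_duflo_moore_unique\<close>
  below, so the existential quantifier over \<^emph>\<open>C\<close> involves no choice.
\<close>

definition admissible ::
    "'g measure \<Rightarrow> ('h, 'm) hilbert_scheme \<Rightarrow> ('g \<Rightarrow> 'h \<Rightarrow> 'h) \<Rightarrow> 'h \<Rightarrow> bool" where
  "admissible M H \<pi> g \<longleftrightarrow>
     g \<in> square_integrable_vectors M H \<pi> \<and>
     (\<exists>C. duflo_moore_operator M H \<pi> C \<and> hnorm H (C g) = 1)"

lemma hnorm_duflo_moore_unique:
  assumes H: "complex_hilbert_space H"
    and C: "duflo_moore_operator M H \<pi> C" and C': "duflo_moore_operator M H \<pi> C'"
    and g: "g \<in> square_integrable_vectors M H \<pi>"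
  shows "hnorm H (C g) = hnorm H (C' g)"
proof -
  interpret complex_hilbert_space H by fact
  have gH: "g \<in> carrier H" and "g \<noteq> \<zero>\<^bsub>H\<^esub>" and gD: "g \<in> duflo_moore_domain M H \<pi>"
    using g by (auto simp: square_integrable_vectors_def duflo_moore_domain_def)
  then have nz: "cinner H g g \<noteq> 0"
    using cinner_eq_zero by blast
  have "cinner H g g * cnj (cinner H (C g) (C g)) = cinner H g g * cnj (cinner H (C' g) (C' g))"
    using C C' gH gD unfolding duflo_moore_operator_def Let_def by metis
  with nz show ?thesis
    by (simp add: hnorm_def)
qed


section \<open>Wavelet completeness\<close>

text \<open>
  The type parameter is the type in which the carriers of the representation spaces live. Two
  unitarily equivalent representations have the same admissible vectors and wavelet transforms up
  to the equivalence, so letting the representation range over all square integrable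
  representations is the same as letting it range over equivalence classes, and any type into which
  the Hilbert spaces in question embed gives the same notion.
\<close>

definition wavelet_functions ::
    "'h itself \<Rightarrow> 'g monoid \<Rightarrow> 'g topology \<Rightarrow> 'g measure \<Rightarrow> ('g \<Rightarrow> complex) set" where
  "wavelet_functions _ G T M =
     {wavelet_transform H \<pi> g f | (H :: 'h hilbert) \<pi> g f.
        square_integrable_representation G T M H \<pi> \<and> admissible M H \<pi> g \<and> f \<in> carrier H}"

definition wavelet_complete ::
    "'h itself \<Rightarrow> 'g monoid \<Rightarrow> 'g topology \<Rightarrow> 'g measure \<Rightarrow> bool" where
  "wavelet_complete h G T M \<longleftrightarrow> L2_dense M (complex_span (wavelet_functions h G T M))"


section \<open>The reduced Heisenberg group\<close>

type_synonym 'n heisenberg = "(real ^ 'n) \<times> (real ^ 'n) \<times> complex"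

definition reduced_heisenberg :: "('n::finite) heisenberg monoid" where
  "reduced_heisenberg =
     \<lparr>carrier = UNIV \<times> UNIV \<times> sphere 0 1,
      mult = (\<lambda>(x, \<omega>, z) (x', \<omega>', z').
        (x + x', \<omega> + \<omega>', z * z' * cis (pi * (x' \<bullet> \<omega> - x \<bullet> \<omega>')))),
      one = (0, 0, 1)\<rparr>"

definition heisenberg_topology :: "('n::finite) heisenberg topology" where
  "heisenberg_topology = top_of_set (carrier reduced_heisenberg)"

definition circle_measure :: "complex measure" where
  "circle_measure =
     distr (restrict_space lborel {0..<1}) (restrict_space borel (sphere 0 1)) (\<lambda>\<tau>. cis (2 * pi * \<tau>))"

definition heisenberg_measure :: "('n::finite) heisenberg measure" where
  "heisenberg_measure = lborel \<Otimes>\<^sub>M lborel \<Otimes>\<^sub>M circle_measure"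

lemma topspace_heisenberg: "topspace heisenberg_topology = carrier reduced_heisenberg"
  by (simp add: heisenberg_topology_def)

lemma space_heisenberg_measure: "space heisenberg_measure = carrier reduced_heisenberg"
  by (simp add: heisenberg_measure_def reduced_heisenberg_def circle_measure_def space_pair_measure)

lemma emeasure_circle: "emeasure circle_measure (sphere 0 1) = 1"
proof -
  have "(\<lambda>\<tau>. cis (2 * pi * \<tau>)) \<in> restrict_space lborel {0..<1} \<rightarrow>\<^sub>M restrict_space borel (sphere 0 1)"
    by (intro measurable_restrict_space1 measurable_restrict_space2)
      (auto intro!: borel_measurable_continuous_onI continuous_intros)
  moreover have "sphere 0 1 \<in> sets (restrict_space borel (sphere (0 :: complex) 1))"
    using sets.top[of "restrict_space borel (sphere (0 :: complex) 1)"]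
    by (simp add: space_restrict_space)
  ultimately have "emeasure circle_measure (sphere 0 1)
      = emeasure (restrict_space lborel {0..<1::real})
          ((\<lambda>\<tau>. cis (2 * pi * \<tau>)) -` sphere 0 1 \<inter> space (restrict_space lborel {0..<1}))"
    unfolding circle_measure_def by (rule emeasure_distr)
  also have "(\<lambda>\<tau>. cis (2 * pi * \<tau>)) -` sphere 0 1 \<inter> space (restrict_space lborel {0..<1}) = {0..<1}"
    by (auto simp: space_restrict_space)
  finally show ?thesis
    by (simp add: emeasure_restrict_space)
qed

lemma group_reduced_heisenberg: "group (reduced_heisenberg :: ('n::finite) heisenberg monoid)"
proof (rule groupI)
  fix a b c :: "'n heisenberg"
  assume carr: "a \<in> carrier reduced_heisenberg" "b \<in> carrier reduced_heisenberg"
    "c \<in> carrier reduced_heisenberg"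
  obtain x \<omega> z x' \<omega>' z' x'' \<omega>'' z''
    where [simp]: "a = (x, \<omega>, z)" "b = (x', \<omega>', z')" "c = (x'', \<omega>'', z'')"
    by (metis prod_cases3)
  have "cis (pi * (x' \<bullet> \<omega> - x \<bullet> \<omega>')) * cis (pi * (x'' \<bullet> (\<omega> + \<omega>') - (x + x') \<bullet> \<omega>''))
      = cis (pi * (x'' \<bullet> \<omega>' - x' \<bullet> \<omega>'')) * cis (pi * ((x' + x'') \<bullet> \<omega> - x \<bullet> (\<omega>' + \<omega>'')))"
    unfolding cis_mult by (rule arg_cong[where f = cis]) (simp add: inner_simps algebra_simps)
  then show "a \<otimes>\<^bsub>reduced_heisenberg\<^esub> b \<otimes>\<^bsub>reduced_heisenberg\<^esub> c
      = a \<otimes>\<^bsub>reduced_heisenberg\<^esub> (b \<otimes>\<^bsub>reduced_heisenberg\<^esub> c)"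
    by (simp add: reduced_heisenberg_def add.assoc mult.assoc mult.left_commute)
next
  fix a :: "'n heisenberg"
  assume a: "a \<in> carrier reduced_heisenberg"
  obtain x \<omega> z where [simp]: "a = (x, \<omega>, z)"
    by (metis prod_cases3)
  have z: "cmod z = 1" "z \<noteq> 0"
    using a by (auto simp: reduced_heisenberg_def)
  show "\<exists>b\<in>carrier reduced_heisenberg. b \<otimes>\<^bsub>reduced_heisenberg\<^esub> a = \<one>\<^bsub>reduced_heisenberg\<^esub>"
  proof
    show "(- x, - \<omega>, inverse z) \<in> carrier reduced_heisenberg"
      using z by (simp add: reduced_heisenberg_def norm_inverse)
    show "(- x, - \<omega>, inverse z) \<otimes>\<^bsub>reduced_heisenberg\<^esub> a = \<one>\<^bsub>reduced_heisenberg\<^esub>"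
      using z by (simp add: reduced_heisenberg_def)
  qed
qed (auto simp: reduced_heisenberg_def norm_mult)

end

theory Submission
  imports Defs
begin

text \<open>
  The obstruction to wavelet completeness is the centre \<^emph>\<open>{(0, 0, w)}\<close> of the group, a circle.
  On a representation with an admissible vector \<^emph>\<open>g\<close> it acts by the conjugate of a character
  \<^emph>\<open>\<gamma>\<close>, so every wavelet transform satisfies \<^emph>\<open>W (x, \<omega>, z w) = \<gamma>(w) W (x, \<omega>, z)\<close>.
  The character cannot be trivial. If it were, the representation would factor through the
  abelian quotient by the centre, all its operators would be scalars of modulus one, and the
  wavelet transform of \<^emph>\<open>g\<close> with itself would have constant non-zero modulus on a group of infinite measure. Since \<^emph>\<open>\<gamma>\<close> is
  non-trivial and the measure is invariant under translation by the centre, the integral of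
  \<^emph>\<open>W\<close> against a function that does not depend on \<^emph>\<open>z\<close> vanishes. All wavelet transforms, of
  all square integrable representations, are therefore orthogonal to the indicator function of a
  cylinder over a unit box, and no element of their span comes closer to it than its own norm.

  In both places where scalars are claimed, Schur's lemma is replaced by the orthogonality
  relations: \<^emph>\<open>commuting_operator_is_phase\<close> derives from them that an operator of the
  representation commuting with all the others is a scalar. It is applied to the centre in
  general and to the whole group when \<^emph>\<open>\<gamma>\<close> is trivial.
\<close>

section \<open>Unitary representations\<close>

lemma unitary_representation_hilbert:
  "unitary_representation G T H \<pi> \<Longrightarrow> complex_hilbert_space H"
  by (simp add: unitary_representation_def)

lemma unitary_representation_unitary:
  assumes "unitary_representation G T H \<pi>" "x \<in> carrier G"
  shows "\<pi> x \<in> unitary_operators H"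
  using assms by (auto simp: unitary_representation_def hom_def unitary_group_def)

lemma unitary_representation_closed:
  assumes "unitary_representation G T H \<pi>" "x \<in> carrier G" "v \<in> carrier H"
  shows "\<pi> x v \<in> carrier H"
  using unitary_representation_unitary[OF assms(1,2)] assms(3)
  by (auto simp: unitary_operators_def linear_map_on_def)

lemma unitary_representation_cinner:
  assumes "unitary_representation G T H \<pi>" "x \<in> carrier G" "v \<in> carrier H" "w \<in> carrier H"
  shows "cinner H (\<pi> x v) (\<pi> x w) = cinner H v w"
  using unitary_representation_unitary[OF assms(1,2)] assms(3,4)
  by (auto simp: unitary_operators_def)

lemma unitary_representation_mult:
  assumes "unitary_representation G T H \<pi>" "x \<in> carrier G" "y \<in> carrier G" "v \<in> carrier H"
  shows "\<pi> (x \<otimes>\<^bsub>G\<^esub> y) v = \<pi> x (\<pi> y v)"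
proof -
  have "\<pi> x \<in> Bij (carrier H)" "\<pi> y \<in> Bij (carrier H)"
    using unitary_representation_unitary[OF assms(1)] assms(2,3)
    by (auto simp: unitary_operators_def)
  moreover have "\<pi> (x \<otimes>\<^bsub>G\<^esub> y) = \<pi> x \<otimes>\<^bsub>unitary_group H\<^esub> \<pi> y"
    using assms(1-3) by (auto simp: unitary_representation_def hom_def)
  ultimately show ?thesis
    using assms(4) by (simp add: unitary_group_def BijGroup_def compose_def)
qed


section \<open>Operators that commute with a square integrable representation\<close>

text \<open>
  If \<^emph>\<open>\<pi> y\<close> commutes with the representation, then replacing both \<^emph>\<open>g\<close> and \<^emph>\<open>f\<close> by their
  images under \<^emph>\<open>\<pi> y\<close> does not change the wavelet transform
  \<^emph>\<open>W g f\<close> of \<^emph>\<open>f\<close> with window \<^emph>\<open>g\<close>. The orthogonality relations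
  evaluate its inner product with \<^emph>\<open>W g h\<close> once as \<^emph>\<open>\<langle>f, h\<rangle>\<close> and once as a multiple
  \<^emph>\<open>d \<langle>\<pi> y f, h\<rangle>\<close> with \<^emph>\<open>d\<close> independent of \<^emph>\<open>f\<close> and \<^emph>\<open>h\<close>, so \<^emph>\<open>\<pi> y\<close> is a scalar.
  Commutation is phrased with matrix coefficients because in the applications it is these that are
  known to agree.
\<close>

lemma commuting_operator_is_phase:
  assumes rep: "unitary_representation G T H \<pi>"
    and adm: "admissible M H \<pi> g"
    and space: "space M = carrier G"
    and y: "y \<in> carrier G"
    and comm: "\<And>x f h. \<lbrakk>x \<in> carrier G; f \<in> carrier H; h \<in> carrier H\<rbrakk>
      \<Longrightarrow> wavelet_transform H \<pi> h f (x \<otimes>\<^bsub>G\<^esub> y) = wavelet_transform H \<pi> h f (y \<otimes>\<^bsub>G\<^esub> x)"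
  shows "\<exists>c. cmod c = 1 \<and>
    (\<forall>f\<in>carrier H. \<forall>h\<in>carrier H. cinner H f (\<pi> y h) = c * cinner H f h)"
proof -
  interpret complex_hilbert_space H
    using rep by (rule unitary_representation_hilbert)
  note closed = unitary_representation_closed[OF rep]
  note unit = unitary_representation_cinner[OF rep]
  note mult = unitary_representation_mult[OF rep]
  from adm obtain C where C: "duflo_moore_operator M H \<pi> C" "hnorm H (C g) = 1"
    and gs: "g \<in> square_integrable_vectors M H \<pi>"
    by (auto simp: admissible_def)
  let ?D = "duflo_moore_domain M H \<pi>"
  have g: "g \<in> carrier H" "g \<noteq> \<zero>\<^bsub>H\<^esub>" "wavelet_transform H \<pi> g g \<in> L2 M" "g \<in> ?D"
    using gs by (auto simp: square_integrable_vectors_def duflo_moore_domain_def)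
  have gg: "cinner H g g \<noteq> 0"
    using g cinner_eq_zero by blast
  have Cg: "C g \<in> carrier H"
    using C(1) g(4) by (auto simp: duflo_moore_operator_def linear_map_on_def Let_def)
  have CC: "cinner H (C g) (C g) = 1"
    using cinner_self[OF Cg] C(2) by simp
  have orth: "L2_inner M (wavelet_transform H \<pi> g\<^sub>1 f\<^sub>1) (wavelet_transform H \<pi> g\<^sub>2 f\<^sub>2)
      = cinner H f\<^sub>1 f\<^sub>2 * cnj (cinner H (C g\<^sub>1) (C g\<^sub>2))"
    if "f\<^sub>1 \<in> carrier H" "f\<^sub>2 \<in> carrier H" "g\<^sub>1 \<in> ?D" "g\<^sub>2 \<in> ?D" for f\<^sub>1 f\<^sub>2 g\<^sub>1 g\<^sub>2
    using C(1) that by (simp add: duflo_moore_operator_def Let_def)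
  have shift: "wavelet_transform H \<pi> (\<pi> y g) (\<pi> y f) x = wavelet_transform H \<pi> g f x"
    if "f \<in> carrier H" "x \<in> space M" for f x
  proof -
    have x: "x \<in> carrier G"
      using that space by simp
    have "wavelet_transform H \<pi> (\<pi> y g) (\<pi> y f) x = wavelet_transform H \<pi> g (\<pi> y f) (x \<otimes>\<^bsub>G\<^esub> y)"
      by (simp add: wavelet_transform_def mult x y g)
    also have "\<dots> = wavelet_transform H \<pi> g (\<pi> y f) (y \<otimes>\<^bsub>G\<^esub> x)"
      by (intro comm x closed y that g)
    also have "\<dots> = wavelet_transform H \<pi> g f x"
      by (simp add: wavelet_transform_def mult x y g unit closed that)
    finally show ?thesis .
  qed
  have "\<pi> y g \<noteq> \<zero>\<^bsub>H\<^esub>"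
  proof
    assume "\<pi> y g = \<zero>\<^bsub>H\<^esub>"
    moreover have "cinner H \<zero>\<^bsub>H\<^esub> \<zero>\<^bsub>H\<^esub> = 0"
      using hnorm_eq_zero cinner_self by simp
    ultimately show False
      using unit[OF y g(1) g(1)] gg by simp
  qed
  moreover have "wavelet_transform H \<pi> (\<pi> y g) (\<pi> y g) \<in> L2 M"
    using g(3) shift[OF g(1)]
    by (auto simp: L2_def cong: measurable_cong Bochner_Integration.integrable_cong)
  ultimately have yg: "\<pi> y g \<in> ?D"
    using closed[OF y g(1)] by (simp add: duflo_moore_domain_def square_integrable_vectors_def)
  define d where "d = cnj (cinner H (C (\<pi> y g)) (C g))"
  have d: "cinner H f h = d * cinner H (\<pi> y f) h" if "f \<in> carrier H" "h \<in> carrier H" for f h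
  proof -
    have "cinner H f h = L2_inner M (wavelet_transform H \<pi> g f) (wavelet_transform H \<pi> g h)"
      using orth[of f h g g] that g CC by simp
    also have "\<dots> = L2_inner M (wavelet_transform H \<pi> (\<pi> y g) (\<pi> y f)) (wavelet_transform H \<pi> g h)"
      unfolding L2_inner_def using shift that by (intro Bochner_Integration.integral_cong) auto
    also have "\<dots> = d * cinner H (\<pi> y f) h"
      using orth[of "\<pi> y f" h "\<pi> y g" g] that g yg closed[OF y] by (simp add: d_def)
    finally show ?thesis .
  qed
  have d0: "d \<noteq> 0"
    using d[OF g(1) g(1)] gg by auto
  define c where "c = cnj (inverse d)"
  have c: "cinner H f (\<pi> y h) = c * cinner H f h" if "f \<in> carrier H" "h \<in> carrier H" for f h
  proof -
    have "cinner H f (\<pi> y h) = cnj (cinner H (\<pi> y h) f)"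
      using that(1) closed[OF y that(2)] by (rule cinner_commute)
    also have "cinner H (\<pi> y h) f = inverse d * cinner H h f"
      using d[OF that(2,1)] d0 by simp
    also have "cnj (inverse d * cinner H h f) = c * cnj (cinner H h f)"
      by (simp add: c_def)
    also have "cnj (cinner H h f) = cinner H f h"
      using cinner_commute[OF that] by (rule sym)
    finally show ?thesis .
  qed
  have "cinner H g g = c * cinner H (\<pi> y g) g"
    using c[OF closed[OF y g(1)] g(1)] unit[OF y g(1) g(1)] by simp
  also have "cinner H (\<pi> y g) g = cnj (cinner H g (\<pi> y g))"
    using closed[OF y g(1)] g(1) by (rule cinner_commute)
  also have "\<dots> = cnj c * cnj (cinner H g g)"
    using c[OF g(1) g(1)] by simp
  also have "cnj (cinner H g g) = cinner H g g"
    using cinner_commute[OF g(1) g(1)] by (rule sym)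
  finally have "cinner H g g = c * cnj c * cinner H g g"
    by (simp only: mult.assoc)
  then have "c * cnj c = 1"
    using gg by simp
  then have "complex_of_real ((cmod c)\<^sup>2) = 1"
    by (simp only: complex_norm_square)
  then have "cmod c = 1"
    by (simp only: of_real_eq_1_iff power2_eq_1_iff) (use norm_ge_zero[of c] in linarith)
  with c show ?thesis
    by blast
qed


section \<open>The measure on the reduced Heisenberg group\<close>

lemma space_circle_measure: "space circle_measure = sphere 0 1"
  and sets_circle_measure [measurable_cong]:
    "sets circle_measure = sets (restrict_space borel (sphere 0 1))"
  by (auto simp: circle_measure_def)

lemma finite_measure_circle: "finite_measure circle_measure"
  by (rule finite_measureI) (simp add: space_circle_measure emeasure_circle)

lemma measurable_circle_parametrization:
  "(\<lambda>\<tau>. cis (2 * pi * \<tau>)) \<in> borel \<rightarrow>\<^sub>M restrict_space borel (sphere 0 1)"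
  by (intro measurable_restrict_space2)
    (auto intro!: borel_measurable_continuous_onI continuous_intros)

lemma emeasure_circle_measure:
  assumes "A \<in> sets circle_measure"
  shows "emeasure circle_measure A = emeasure lborel ({\<tau>. cis (2 * pi * \<tau>) \<in> A} \<inter> {0..<1})"
proof -
  have "emeasure circle_measure A = emeasure (restrict_space lborel {0..<1::real})
          ((\<lambda>\<tau>. cis (2 * pi * \<tau>)) -` A \<inter> space (restrict_space lborel {0..<1}))"
    unfolding circle_measure_def
    using assms measurable_circle_parametrization
    by (intro emeasure_distr measurable_restrict_space1) (auto simp: sets_circle_measure)
  also have "\<dots> = emeasure lborel ((\<lambda>\<tau>. cis (2 * pi * \<tau>)) -` A \<inter> space (restrict_space lborel {0..<1}))"
    by (subst emeasure_restrict_space) (auto simp: space_restrict_space)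
  finally show ?thesis
    by (simp add: space_restrict_space vimage_def)
qed

text \<open>
  A 1-periodic set has the same measure in every half-open interval of length one: the part that
  leaves the unit interval on the right re-enters it on the left.
\<close>

lemma emeasure_periodic_shift:
  fixes S :: "real set"
  assumes S [measurable]: "S \<in> sets borel" and per: "\<And>t. t + 1 \<in> S \<longleftrightarrow> t \<in> S"
    and a: "0 \<le> a" "a < 1"
  shows "emeasure lborel ({t. t + a \<in> S} \<inter> {0..<1}) = emeasure lborel (S \<inter> {0..<1})"
proof -
  have translate: "emeasure lborel {t. t + b \<in> B} = emeasure lborel B"
    if "B \<in> sets borel" for b :: real and B
  proof -
    have "emeasure lborel B = emeasure (distr lborel borel ((+) b)) B"
      by (simp add: lborel_distr_plus)
    also have "\<dots> = emeasure lborel {t. t + b \<in> B}"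
      using that by (subst emeasure_distr) (auto simp: vimage_def add.commute)
    finally show ?thesis ..
  qed
  have "{t. t + a \<in> S} \<inter> {0..<1} = {t. t + a \<in> S \<inter> {a..<1 + a}}"
    by auto
  then have "emeasure lborel ({t. t + a \<in> S} \<inter> {0..<1}) = emeasure lborel (S \<inter> {a..<1 + a})"
    using translate[of "S \<inter> {a..<1 + a}" a] by simp
  also have "S \<inter> {a..<1 + a} = (S \<inter> {a..<1}) \<union> (S \<inter> {1..<1 + a})"
    using a by auto
  also have "emeasure lborel \<dots> = emeasure lborel (S \<inter> {a..<1}) + emeasure lborel (S \<inter> {1..<1 + a})"
    by (rule plus_emeasure[symmetric]) auto
  also have "emeasure lborel (S \<inter> {1..<1 + a}) = emeasure lborel (S \<inter> {0..<a})"
  proof -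
    have "{t. t + 1 \<in> S \<inter> {1..<1 + a}} = S \<inter> {0..<a}"
      using per by auto
    then show ?thesis
      using translate[of "S \<inter> {1..<1 + a}" 1] by simp
  qed
  also have "emeasure lborel (S \<inter> {a..<1}) + emeasure lborel (S \<inter> {0..<a})
      = emeasure lborel ((S \<inter> {a..<1}) \<union> (S \<inter> {0..<a}))"
    by (rule plus_emeasure) auto
  also have "(S \<inter> {a..<1}) \<union> (S \<inter> {0..<a}) = S \<inter> {0..<1}"
    using a by auto
  finally show ?thesis .
qed

lemma measurable_circle_rotation:
  assumes "cmod w = 1"
  shows "(\<lambda>z. z * w) \<in> circle_measure \<rightarrow>\<^sub>M circle_measure"
proof -
  have "(\<lambda>z. z * w) \<in> restrict_space borel (sphere 0 1) \<rightarrow>\<^sub>M restrict_space borel (sphere 0 1)"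
    using assms
    by (intro measurable_restrict_space2 measurable_restrict_space1)
      (auto simp: space_restrict_space norm_mult
        intro!: borel_measurable_continuous_onI continuous_intros)
  then show ?thesis
    by (simp cong: measurable_cong_sets add: sets_circle_measure)
qed

lemma circle_measure_rotation_invariant:
  assumes w: "cmod w = 1"
  shows "distr circle_measure circle_measure (\<lambda>z. z * w) = circle_measure"
proof (rule measure_eqI)
  fix A assume "A \<in> sets (distr circle_measure circle_measure (\<lambda>z. z * w))"
  then have A: "A \<in> sets circle_measure"
    by simp
  define S where "S = {\<tau>. cis (2 * pi * \<tau>) \<in> A}"
  have S: "S \<in> sets borel"
    using measurable_sets[OF measurable_circle_parametrization, of A] A
    by (simp add: S_def vimage_def sets_circle_measure)
  obtain t where t: "0 \<le> t" "t < 2 * pi" "w = cis t"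
    using complex_unimodular_polar[OF w] by (auto simp: cis.code Complex_eq)
  define a where "a = t / (2 * pi)"
  have a: "0 \<le> a" "a < 1" "w = cis (2 * pi * a)"
    using t by (auto simp: a_def)
  note rot = measurable_circle_rotation[OF w]
  have B: "(\<lambda>z. z * w) -` A \<inter> space circle_measure \<in> sets circle_measure"
    using measurable_sets[OF rot A] .
  have per: "t + 1 \<in> S \<longleftrightarrow> t \<in> S" for t
    by (simp add: S_def distrib_left flip: cis_mult)
  have "{\<tau>. cis (2 * pi * \<tau>) \<in> (\<lambda>z. z * w) -` A \<inter> space circle_measure} = {\<tau>. \<tau> + a \<in> S}"
    by (simp add: S_def a(3) space_circle_measure cis_mult distrib_left)
  then show "emeasure (distr circle_measure circle_measure (\<lambda>z. z * w)) A = emeasure circle_measure A"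
    using emeasure_periodic_shift[OF S per a(1,2)] rot A B
    by (simp add: emeasure_distr emeasure_circle_measure S_def)
qed simp

text \<open>
  The phase in the group law is absent when one factor is central, so translation by \<^emph>\<open>(0, 0, w)\<close>
  only rotates the circle coordinate.
\<close>

lemma heisenberg_measure_central_invariant:
  assumes w: "cmod w = 1"
  shows "distr heisenberg_measure heisenberg_measure (\<lambda>(x, \<omega>, z). (x, \<omega>, z * w))
    = (heisenberg_measure :: ('n::finite) heisenberg measure)"
    and "(\<lambda>(x, \<omega>, z). (x, \<omega>, z * w)) \<in> heisenberg_measure \<rightarrow>\<^sub>M
      (heisenberg_measure :: 'n heisenberg measure)"
proof -
  interpret circle: finite_measure circle_measure
    by (rule finite_measure_circle)
  let ?L = "lborel :: (real ^ 'n) measure"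
  let ?r = "\<lambda>z. z * w"
  have rot [measurable]: "?r \<in> circle_measure \<rightarrow>\<^sub>M circle_measure"
    using w by (rule measurable_circle_rotation)
  interpret LC: pair_sigma_finite ?L circle_measure ..
  have 1: "distr (?L \<Otimes>\<^sub>M circle_measure) (?L \<Otimes>\<^sub>M circle_measure) (\<lambda>(x, z). (x, ?r z))
      = ?L \<Otimes>\<^sub>M circle_measure"
  proof -
    have "distr ?L ?L (\<lambda>x. x) \<Otimes>\<^sub>M distr circle_measure circle_measure ?r
        = distr (?L \<Otimes>\<^sub>M circle_measure) (?L \<Otimes>\<^sub>M circle_measure) (\<lambda>(x, z). (x, ?r z))"
      by (rule pair_measure_distr[OF measurable_ident_sets[OF refl] rot])
        (unfold circle_measure_rotation_invariant[OF w], rule circle.sigma_finite_measure_axioms)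
    then show ?thesis
      unfolding circle_measure_rotation_invariant[OF w] distr_id2[OF refl] by (rule sym)
  qed
  have m: "(\<lambda>(x, z). (x, ?r z)) \<in> ?L \<Otimes>\<^sub>M circle_measure \<rightarrow>\<^sub>M ?L \<Otimes>\<^sub>M circle_measure"
    by measurable
  let ?LLC = "?L \<Otimes>\<^sub>M ?L \<Otimes>\<^sub>M circle_measure"
  have f_eq: "(\<lambda>(x, \<omega>, z). (x, \<omega>, z * w)) = (\<lambda>(x, p). (x, (\<lambda>(\<omega>, z). (\<omega>, ?r z)) p))"
    by auto
  have 2: "distr ?LLC ?LLC (\<lambda>(x, p). (x, (\<lambda>(\<omega>, z). (\<omega>, ?r z)) p)) = ?LLC"
  proof -
    have "distr ?L ?L (\<lambda>x. x)
          \<Otimes>\<^sub>M distr (?L \<Otimes>\<^sub>M circle_measure) (?L \<Otimes>\<^sub>M circle_measure) (\<lambda>(\<omega>, z). (\<omega>, ?r z))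
        = distr ?LLC ?LLC (\<lambda>(x, p). (x, (\<lambda>(\<omega>, z). (\<omega>, ?r z)) p))"
      by (rule pair_measure_distr[OF measurable_ident_sets[OF refl] m])
        (unfold 1, rule LC.sigma_finite_measure_axioms)
    then show ?thesis
      unfolding 1 distr_id2[OF refl] by (rule sym)
  qed
  show "distr heisenberg_measure heisenberg_measure (\<lambda>(x, \<omega>, z). (x, \<omega>, z * w))
    = (heisenberg_measure :: 'n heisenberg measure)"
    unfolding heisenberg_measure_def f_eq by (rule 2)
  have "(\<lambda>q. (fst q, (\<lambda>(\<omega>, z). (\<omega>, ?r z)) (snd q))) \<in> ?LLC \<rightarrow>\<^sub>M ?LLC"
    by (rule measurable_Pair[OF measurable_fst measurable_compose[OF measurable_snd m]])
  then show "(\<lambda>(x, \<omega>, z). (x, \<omega>, z * w)) \<in> heisenberg_measure \<rightarrow>\<^sub>M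
      (heisenberg_measure :: 'n heisenberg measure)"
    unfolding heisenberg_measure_def by (simp only: case_prod_unfold)
qed

lemma emeasure_heisenberg_times:
  fixes A B :: "(real ^ 'n::finite) set"
  assumes "A \<in> sets borel" "B \<in> sets borel"
  shows "emeasure heisenberg_measure (A \<times> B \<times> sphere 0 1) = emeasure lborel A * emeasure lborel B"
    and "A \<times> B \<times> sphere 0 1 \<in> sets heisenberg_measure"
proof -
  interpret circle: finite_measure circle_measure
    by (rule finite_measure_circle)
  interpret LC: pair_sigma_finite "lborel :: (real ^ 'n) measure" circle_measure ..
  have s: "sphere 0 1 \<in> sets circle_measure"
    using sets.top[of circle_measure] by (simp add: space_circle_measure)
  show "emeasure heisenberg_measure (A \<times> B \<times> sphere 0 1) = emeasure lborel A * emeasure lborel B"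
    using assms s
    by (simp add: heisenberg_measure_def LC.emeasure_pair_measure_Times
        circle.emeasure_pair_measure_Times emeasure_circle)
  show "A \<times> B \<times> sphere 0 1 \<in> sets heisenberg_measure"
    using assms s by (simp add: heisenberg_measure_def)
qed

lemma emeasure_heisenberg_space:
  "emeasure (heisenberg_measure :: ('n::finite) heisenberg measure) (space heisenberg_measure) = \<infinity>"
  using emeasure_heisenberg_times(1)[of "UNIV :: (real ^ 'n) set" UNIV]
  by (simp add: space_heisenberg_measure reduced_heisenberg_def ennreal_top_mult)

text \<open>
  This set has the two features that the argument needs: it is a union of cosets of the centre, and
  its measure is positive and finite.
\<close>

definition unit_cylinder :: "('n::finite) heisenberg set" where
  "unit_cylinder = cbox 0 One \<times> cbox 0 One \<times> sphere 0 1"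

lemma emeasure_unit_cylinder: "emeasure heisenberg_measure unit_cylinder = 1"
  and sets_unit_cylinder [measurable]: "unit_cylinder \<in> sets heisenberg_measure"
  unfolding unit_cylinder_def
  by (simp_all add: emeasure_heisenberg_times)

lemma integrable_unit_cylinder_L2:
  assumes "F \<in> L2 heisenberg_measure"
  shows "integrable heisenberg_measure (\<lambda>p. indicator unit_cylinder p * F p)"
proof (rule Bochner_Integration.integrable_bound)
  show "integrable heisenberg_measure (\<lambda>p. indicator unit_cylinder p + (cmod (F p))\<^sup>2 :: real)"
    using assms by (auto simp: L2_def emeasure_unit_cylinder)
  show "(\<lambda>p. indicator unit_cylinder p * F p) \<in> borel_measurable heisenberg_measure"
    using assms by (auto simp: L2_def)
  have "r \<le> 1 + r\<^sup>2" for r :: real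
    using zero_le_power2[of "r - 1 / 2"] by (simp add: power2_diff power_divide)
  then show "AE p in heisenberg_measure. cmod (indicator unit_cylinder p * F p)
      \<le> norm (indicator unit_cylinder p + (cmod (F p))\<^sup>2 :: real)"
    by (auto simp: indicator_def norm_mult)
qed


section \<open>Wavelet transforms on the reduced Heisenberg group\<close>

text \<open>
  Translation by a central element \<^emph>\<open>w\<close> preserves the integral but multiplies the integrand by
  \<^emph>\<open>\<gamma> w\<close>, so the integral is zero as soon as some \<^emph>\<open>\<gamma> w\<close> differs from one. That such a
  \<^emph>\<open>w\<close> exists is where square integrability enters.
\<close>

lemma wavelet_functions_orthogonal_unit_cylinder:
  assumes "W \<in> wavelet_functions TYPE('h) (reduced_heisenberg :: ('n::finite) heisenberg monoid)
    heisenberg_topology heisenberg_measure"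
  shows "W \<in> L2 heisenberg_measure"
    and "(LINT p|heisenberg_measure. indicator unit_cylinder p * W p) = 0"
proof -
  let ?G = "reduced_heisenberg :: 'n heisenberg monoid"
  let ?M = "heisenberg_measure :: 'n heisenberg measure"
  from assms obtain H :: "'h hilbert" and \<pi> g f where W: "W = wavelet_transform H \<pi> g f"
    and rep: "unitary_representation ?G heisenberg_topology H \<pi>"
    and adm: "admissible ?M H \<pi> g" and f: "f \<in> carrier H"
    by (auto simp: wavelet_functions_def square_integrable_representation_def)
  interpret complex_hilbert_space H
    using rep by (rule unitary_representation_hilbert)
  have g: "g \<in> carrier H" "g \<noteq> \<zero>\<^bsub>H\<^esub>" "wavelet_transform H \<pi> g g \<in> L2 ?M"
    using adm by (auto simp: admissible_def square_integrable_vectors_def)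
  have gg: "cinner H g g \<noteq> 0"
    using g cinner_eq_zero by blast
  show WL2: "W \<in> L2 heisenberg_measure"
    using adm f by (auto simp: W admissible_def duflo_moore_operator_def duflo_moore_domain_def Let_def)
  note closed = unitary_representation_closed[OF rep]
  note mult = unitary_representation_mult[OF rep]
  note phase = commuting_operator_is_phase[OF rep adm space_heisenberg_measure]
  have central: "(x, \<omega>, z) \<otimes>\<^bsub>?G\<^esub> (0, 0, w) = (x, \<omega>, z * w)"
    "(0, 0, w) \<otimes>\<^bsub>?G\<^esub> (x, \<omega>, z) = (x, \<omega>, z * w)" for x \<omega> z w
    by (simp_all add: reduced_heisenberg_def mult.commute)
  have carrier: "(x, \<omega>, z) \<in> carrier ?G \<longleftrightarrow> cmod z = 1" for x \<omega> z
    by (simp add: reduced_heisenberg_def)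
  have "\<exists>c. \<forall>h\<in>carrier H. \<forall>k\<in>carrier H. cinner H h (\<pi> (0, 0, w) k) = c * cinner H h k"
    if "cmod w = 1" for w
  proof -
    have w: "(0, 0, w) \<in> carrier ?G"
      using that by (simp add: carrier)
    have comm: "wavelet_transform H \<pi> k h (x \<otimes>\<^bsub>?G\<^esub> (0, 0, w))
        = wavelet_transform H \<pi> k h ((0, 0, w) \<otimes>\<^bsub>?G\<^esub> x)"
      if "x \<in> carrier ?G" "h \<in> carrier H" "k \<in> carrier H" for x h k
      by (cases x) (simp add: central)
    show ?thesis
      using phase[OF w comm] by blast
  qed
  then obtain \<gamma> where \<gamma>: "cinner H h (\<pi> (0, 0, w) k) = \<gamma> w * cinner H h k"
    if "cmod w = 1" "h \<in> carrier H" "k \<in> carrier H" for w h k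
    by metis
  have W_central: "wavelet_transform H \<pi> k h (x, \<omega>, z * w)
      = \<gamma> w * wavelet_transform H \<pi> k h (x, \<omega>, z)"
    if "cmod z = 1" "cmod w = 1" "h \<in> carrier H" "k \<in> carrier H" for x \<omega> z w h k
    using that mult[of "(0, 0, w)" "(x, \<omega>, z)" k] \<gamma>[of w h "\<pi> (x, \<omega>, z) k"]
      closed[of "(x, \<omega>, z)" k]
    by (simp add: wavelet_transform_def carrier central)
  \<comment> \<open>With a trivial central character the transforms live on the abelian quotient, so every operator
    of the representation is a phase.\<close>
  have "\<exists>w. cmod w = 1 \<and> \<gamma> w \<noteq> 1"
  proof (rule ccontr)
    assume "\<nexists>w. cmod w = 1 \<and> \<gamma> w \<noteq> 1"
    then have triv: "\<gamma> w = 1" if "cmod w = 1" for w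
      using that by blast
    have indep: "wavelet_transform H \<pi> k h (x, \<omega>, z) = wavelet_transform H \<pi> k h (x, \<omega>, 1)"
      if "cmod z = 1" "h \<in> carrier H" "k \<in> carrier H" for x \<omega> z h k
      using W_central[of 1 z h k x \<omega>] triv[of z] that by simp
    have "cmod (wavelet_transform H \<pi> g g y) = cmod (cinner H g g)" if y: "y \<in> space ?M" for y
    proof -
      have y: "y \<in> carrier ?G"
        using y by (simp add: space_heisenberg_measure)
      have comm: "wavelet_transform H \<pi> k h (x \<otimes>\<^bsub>?G\<^esub> y) = wavelet_transform H \<pi> k h (y \<otimes>\<^bsub>?G\<^esub> x)"
        if "x \<in> carrier ?G" "h \<in> carrier H" "k \<in> carrier H" for x h k
      proof -
        obtain x1 x2 x3 y1 y2 y3 where xy: "x = (x1, x2, x3)" "y = (y1, y2, y3)"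
          by (metis prod_cases3)
        define u where "u = cis (pi * (y1 \<bullet> x2 - x1 \<bullet> y2))"
        define v where "v = cis (pi * (x1 \<bullet> y2 - y1 \<bullet> x2))"
        have xy': "x \<otimes>\<^bsub>?G\<^esub> y = (x1 + y1, x2 + y2, x3 * y3 * u)"
          "y \<otimes>\<^bsub>?G\<^esub> x = (x1 + y1, x2 + y2, y3 * x3 * v)"
          by (simp_all add: xy reduced_heisenberg_def u_def v_def add.commute)
        have "cmod (x3 * y3 * u) = 1" "cmod (y3 * x3 * v) = 1"
          using that(1) y by (simp_all add: xy carrier norm_mult u_def v_def)
        then show ?thesis
          unfolding xy' using indep that(2,3) by metis
      qed
      from phase[OF y comm] show ?thesis
        using g by (auto simp: wavelet_transform_def norm_mult)
    qed
    then have "integrable ?M (\<lambda>p. (cmod (cinner H g g))\<^sup>2)"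
      using g(3) by (simp add: L2_def cong: Bochner_Integration.integrable_cong)
    then have "ennreal ((cmod (cinner H g g))\<^sup>2) * emeasure ?M (space ?M) < \<infinity>"
      by (simp add: integrable_iff_bounded)
    then show False
      using gg by (simp add: emeasure_heisenberg_space ennreal_mult_top)
  qed
  then obtain w where w: "cmod w = 1" "\<gamma> w \<noteq> 1"
    by blast
  let ?r = "\<lambda>(x, \<omega>, z). (x, \<omega>, z * w) :: 'n heisenberg"
  have KW: "(\<lambda>p. indicator unit_cylinder p * W p) \<in> borel_measurable ?M"
    using integrable_unit_cylinder_L2[OF WL2] by auto
  have "(LINT p|?M. indicator unit_cylinder p * W p)
      = (LINT p|distr ?M ?M ?r. indicator unit_cylinder p * W p)"
    by (simp add: heisenberg_measure_central_invariant[OF w(1)])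
  also have "\<dots> = (LINT p|?M. indicator unit_cylinder (?r p) * W (?r p))"
    by (rule integral_distr[OF heisenberg_measure_central_invariant(2)[OF w(1)] KW])
  also have "\<dots> = (LINT p|?M. \<gamma> w * (indicator unit_cylinder p * W p))"
  proof (rule Bochner_Integration.integral_cong)
    fix p assume p: "p \<in> space ?M"
    obtain x \<omega> z where xz: "p = (x, \<omega>, z)"
      by (metis prod_cases3)
    have "cmod z = 1"
      using p by (simp add: xz space_heisenberg_measure carrier)
    then show "indicator unit_cylinder (?r p) * W (?r p) = \<gamma> w * (indicator unit_cylinder p * W p)"
      using W_central[of z w f g x \<omega>] w f g
      by (simp add: xz W unit_cylinder_def indicator_def norm_mult)
  qed simp
  finally show "(LINT p|heisenberg_measure. indicator unit_cylinder p * W p) = 0"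
    using w(2) by simp
qed

section \<open>Failure of wavelet completeness\<close>

theorem proposition1p5:
  shows "\<not> wavelet_complete TYPE('h) (reduced_heisenberg :: ('n::finite) heisenberg monoid)
           heisenberg_topology heisenberg_measure"
proof
  let ?M = "heisenberg_measure :: 'n heisenberg measure"
  let ?K = "indicator unit_cylinder :: 'n heisenberg \<Rightarrow> complex"
  let ?S = "wavelet_functions TYPE('h) reduced_heisenberg heisenberg_topology ?M"
  assume "wavelet_complete TYPE('h) (reduced_heisenberg :: 'n heisenberg monoid)
           heisenberg_topology heisenberg_measure"
  moreover have "?K \<in> L2 ?M"
  proof -
    have "(cmod (?K p))\<^sup>2 = indicator unit_cylinder p" for p
      by (simp add: indicator_def)
    then show ?thesis
      by (simp add: L2_def emeasure_unit_cylinder)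
  qed
  ultimately have "\<forall>\<epsilon>>0. \<exists>F\<in>complex_span ?S.
      (\<integral>\<^sup>+p. ennreal ((cmod (?K p - F p))\<^sup>2) \<partial>?M) < ennreal (\<epsilon>\<^sup>2)"
    unfolding wavelet_complete_def L2_dense_def by (rule bspec)
  from spec[OF this, of 1] obtain F where F: "F \<in> complex_span ?S"
    and close: "(\<integral>\<^sup>+p. ennreal ((cmod (?K p - F p))\<^sup>2) \<partial>?M) < 1"
    by auto
  from F obtain A c where A: "finite A" "A \<subseteq> ?S" and F_eq: "F = (\<lambda>p. \<Sum>W\<in>A. c W * W p)"
    by (auto simp: complex_span_def)
  note orth = wavelet_functions_orthogonal_unit_cylinder[OF subsetD[OF A(2)]]
  have F_meas [measurable]: "F \<in> borel_measurable ?M"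
    unfolding F_eq using orth(1) by (intro borel_measurable_sum borel_measurable_times) (auto simp: L2_def)
  have KF: "?K p * F p = (\<Sum>W\<in>A. c W * (?K p * W p))" for p
    by (simp add: F_eq sum_distrib_left mult_ac)
  have int: "integrable ?M (\<lambda>p. ?K p * F p)"
    unfolding KF
    by (intro Bochner_Integration.integrable_sum integrable_mult_right
        integrable_unit_cylinder_L2 orth(1))
  have zero: "(LINT p|?M. ?K p * F p) = 0"
    unfolding KF
    by (subst Bochner_Integration.integral_sum)
      (simp_all add: orth integrable_unit_cylinder_L2)
  have sq: "integrable ?M (\<lambda>p. (cmod (?K p - F p))\<^sup>2)"
    using close by (intro integrableI_bounded) (auto intro: order.strict_trans)
  have ind: "integrable ?M (indicator unit_cylinder :: _ \<Rightarrow> real)"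
    by (simp add: emeasure_unit_cylinder)
  have intRe: "integrable ?M (\<lambda>p. 2 * Re (?K p * F p))"
    by (intro integrable_mult_right integrable_Re int)
  have "(LINT p|?M. 2 * Re (?K p * F p)) = 0"
    by (simp only: integral_mult_right_zero integral_Re[OF int] zero) simp
  \<comment> \<open>Integrating the estimate \<^term>\<open>(cmod (1 - u))\<^sup>2 \<ge> 1 - 2 * Re u\<close> at \<^emph>\<open>u = F p\<close> over the cylinder removes the
    linear term by orthogonality.\<close>
  then have "1 = (LINT p|?M. indicator unit_cylinder p - 2 * Re (?K p * F p))"
    unfolding Bochner_Integration.integral_diff[OF ind intRe]
    by (simp add: emeasure_unit_cylinder measure_def)
  also have "\<dots> \<le> (LINT p|?M. (cmod (?K p - F p))\<^sup>2)"
  proof (rule integral_mono)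
    show "integrable ?M (\<lambda>p. indicator unit_cylinder p - 2 * Re (?K p * F p))"
      using ind intRe by (rule Bochner_Integration.integrable_diff)
    have "1 - 2 * Re u \<le> (cmod (1 - u))\<^sup>2" for u
      unfolding cmod_power2 by (simp add: power2_diff)
    then show "indicator unit_cylinder p - 2 * Re (?K p * F p) \<le> (cmod (?K p - F p))\<^sup>2" for p
      by (cases "p \<in> unit_cylinder") simp_all
  qed (rule sq)
  also have "\<dots> < 1"
    using close sq by (simp add: nn_integral_eq_integral)
  finally show False
    by simp
qed

end
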